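(* Let $d\mu$ be a nontrivial probability measure on $\partial\mathbb{D}$ with CMV matrix $\mathcal{C}$, let $d\nu_n$ be the density of zeros of $\Phi_n(z;d\mu)$, let $\mathcal{C}^{(n)}$ be the matrix formed from the topmost $n$ rows and leftmost $n$ columns of $\mathcal{C}$, and let $$d\gamma_n(\theta)=\frac1n\sum_{j=0}^{n-1}|\varphi_j(e^{i\theta};d\mu)|^2\,d\mu(\theta).$$ Then for any integer $k\ge0$ (and any $n\ge1$), $$\int z^k\,d\nu_n(z)=\frac1n\operatorname{Tr}\bigl((\mathcal{C}^{(n)})^k\bigr).$$ Moreover, for any integer $k\ge 0$, $$\lim_{n\to\infty}\left[\left(\int z^k\,d\nu_n(z)\right)-\left(\int z^k\,d\gamma_n(z)\right)\right]=0.$$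
   Context: $\mathbb{D}=\{|z|<1\}$. A probability measure on $\partial\mathbb{D}$ is nontrivial if it is not a finite combination of delta functions. $\Phi_n(z;d\mu)$ is the monic orthogonal polynomial of degree $n$ in $L^2(\partial\mathbb{D},d\mu)$, $\varphi_n=\Phi_n/\|\Phi_n\|_{L^2}$, and the Verblunsky coefficients are $\alpha_n=-\overline{\Phi_{n+1}(0)}\in\mathbb{D}$, $n\ge0$. The density of zeros $d\nu_n$ is the probability measure on $\mathbb{C}$ giving weight $m/n$ to each zero of $\Phi_n$ of multiplicity $m$. The CMV matrix is $\mathcal{C}_{nm}=\langle\chi_n,z\chi_m\rangle_{L^2(d\mu)}$, $n,m\ge0$, where $\{\chi_n\}_{n=0}^\infty$ is the orthonormal basis of $L^2(\partial\mathbb{D},d\mu)$ obtained by applying Gram–Schmidt to $1,z,z^{-1},z^2,z^{-2},\dots$. Equivalently $\mathcal{C}=\mathcal{L}\mathcal{M}$ with $\mathcal{L}=\Theta_0\oplus\Theta_2\oplus\Theta_4\oplus\cdots$ and $\mathcal{M}=1\oplus\Theta_1\oplus\Theta_3\oplus\cdots$ (the $1$ being a $1\times1$ block), $\Theta_j=\begin{pmatrix}\bar\alpha_j&\rho_j\\ \rho_j&-\alpha_j\end{pmatrix}$, $\rho_j=(1-|\alpha_j|^2)^{1/2}$. *)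

theory Defs
  imports
    "HOL-Probability.Probability"
    "HOL-Computational_Algebra.Polynomial"
    "Jordan_Normal_Form.Matrix"
begin

text \<open>
  The unit circle is \<^term>\<open>sphere 0 1 :: complex set\<close> with its Borel sets. Functions in $L^2$ are
  represented by ordinary functions \<^typ>\<open>complex \<Rightarrow> complex\<close>; only their values on the circle matter.
\<close>

definition nontrivial_circle_measure :: "complex measure \<Rightarrow> bool" where
  "nontrivial_circle_measure M \<longleftrightarrow>
     prob_space M \<and>
     sets M = sets (restrict_space borel (sphere 0 1)) \<and>
     \<not> (\<exists>S (c :: complex \<Rightarrow> real). finite S \<and>
          (\<forall>A\<in>sets M. measure M A = (\<Sum>s\<in>S. c s * indicator A s)))"

(* antilinear in the first argument *)
definition L2_inner :: "complex measure \<Rightarrow> (complex \<Rightarrow> complex) \<Rightarrow> (complex \<Rightarrow> complex) \<Rightarrow> complex" where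
  "L2_inner M f g = (LINT z|M. cnj (f z) * g z)"

definition L2_nrm :: "complex measure \<Rightarrow> (complex \<Rightarrow> complex) \<Rightarrow> real" where
  "L2_nrm M f = sqrt (LINT z|M. (cmod (f z))\<^sup>2)"

definition monic_OP :: "complex measure \<Rightarrow> nat \<Rightarrow> complex poly" where
  "monic_OP M n = (THE p. degree p = n \<and> lead_coeff p = 1 \<and>
     (\<forall>j<n. L2_inner M (\<lambda>z. z ^ j) (poly p) = 0))"

definition orthonormal_OP :: "complex measure \<Rightarrow> nat \<Rightarrow> complex \<Rightarrow> complex" where
  "orthonormal_OP M n z = poly (monic_OP M n) z / of_real (L2_nrm M (poly (monic_OP M n)))"

definition zero_density :: "complex measure \<Rightarrow> nat \<Rightarrow> complex measure" where
  "zero_density M n =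
     distr (point_measure {z. poly (monic_OP M n) z = 0}
              (\<lambda>z. ennreal (real (Polynomial.order z (monic_OP M n)) / real n)))
       borel (\<lambda>z. z)"

definition OP_average_measure :: "complex measure \<Rightarrow> nat \<Rightarrow> complex measure" where
  "OP_average_measure M n =
     density M (\<lambda>z. ennreal (1 / real n * (\<Sum>j<n. (cmod (orthonormal_OP M j z))\<^sup>2)))"

definition L2_normalize :: "complex measure \<Rightarrow> (complex \<Rightarrow> complex) \<Rightarrow> complex \<Rightarrow> complex" where
  "L2_normalize M f = (\<lambda>z. f z / of_real (L2_nrm M f))"

fun gram_schmidt_L2 ::
  "complex measure \<Rightarrow> (nat \<Rightarrow> complex \<Rightarrow> complex) \<Rightarrow> nat \<Rightarrow> complex \<Rightarrow> complex" where
  "gram_schmidt_L2 M f n =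
     L2_normalize M (\<lambda>z. f n z -
       (\<Sum>m<n. L2_inner M (gram_schmidt_L2 M f m) (f n) * gram_schmidt_L2 M f m z))"

declare gram_schmidt_L2.simps [simp del]

(* the sequence 1, z, 1/z, z^2, 1/z^2, ... *)
definition CMV_monomial :: "nat \<Rightarrow> complex \<Rightarrow> complex" where
  "CMV_monomial n z = z powi (if even n then - int (n div 2) else int ((n + 1) div 2))"

definition CMV_basis :: "complex measure \<Rightarrow> nat \<Rightarrow> complex \<Rightarrow> complex" where
  "CMV_basis M = gram_schmidt_L2 M CMV_monomial"

definition CMV :: "complex measure \<Rightarrow> nat \<Rightarrow> nat \<Rightarrow> complex" where
  "CMV M n m = L2_inner M (CMV_basis M n) (\<lambda>z. z * CMV_basis M m z)"

definition CMV_trunc :: "complex measure \<Rightarrow> nat \<Rightarrow> complex mat" where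
  "CMV_trunc M n = mat n n (\<lambda>(i, j). CMV M i j)"

definition mat_trace :: "complex mat \<Rightarrow> complex" where
  "mat_trace A = (\<Sum>i<dim_row A. A $$ (i, i))"

end

theory Submission
  imports
    Defs
    "Jordan_Normal_Form.Determinant"
    "HOL-Computational_Algebra.Fundamental_Theorem_Algebra"
begin

text \<open>
  The first n CMV basis functions span the functions z to the power -l times a polynomial of degree
  less than n, where l = (n - 1) div 2, so truncating the CMV matrix amounts to compressing
  multiplication by z to that space. In the Newton basis built from the zeros a_i of the monic
  orthogonal polynomial, multiplication by z is bidiagonal with diagonal a_i, because that polynomial
  itself projects to 0; hence the trace of the k-th power of the truncation is the sum of the a_i^k.
  The same holds for every orthonormal basis of a shifted polynomial space, in particular for the
  orthonormal polynomials themselves (the GGT matrix). For the latter, the k-th power of the truncation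
  has the diagonal entries of the untruncated multiplication by z^k except in the last k places, and
  since all these entries are bounded by 1, the two traces differ by at most 2k.
\<close>

subsection \<open>Matrix powers, roots and finite sums\<close>

lemma index_mult_square_mat:
  assumes "A \<in> carrier_mat n n" "B \<in> carrier_mat n n" "i < n" "j < n"
  shows "(A * B) $$ (i, j) = (\<Sum>m<n. A $$ (i, m) * B $$ (m, j))"
  using assms by (simp add: scalar_prod_def atLeast0LessThan)

text \<open>The recursion of \<open>pow_mat\<close> adds the new factor on the right; following a
  fixed column through the powers needs it on the left.\<close>

lemma pow_mat_Suc_left:
  assumes "A \<in> carrier_mat n n"
  shows "A ^\<^sub>m Suc k = A * A ^\<^sub>m k"
proof (induction k)
  case (Suc k)
  have "A ^\<^sub>m Suc (Suc k) = A * A ^\<^sub>m k * A"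
    using Suc by simp
  also have "\<dots> = A * A ^\<^sub>m Suc k"
    using assms by (simp add: assoc_mult_mat[of _ n n _ n _ n])
  finally show ?case .
qed (use assms in simp)

lemma mat_trace_mult_commute:
  assumes "A \<in> carrier_mat n n" "B \<in> carrier_mat n n"
  shows "mat_trace (A * B) = mat_trace (B * A)"
proof -
  have "mat_trace (A * B) = (\<Sum>i<n. \<Sum>m<n. A $$ (i, m) * B $$ (m, i))"
    using assms by (auto simp: mat_trace_def index_mult_square_mat intro!: sum.cong simp del: index_mult_mat(1))
  also have "\<dots> = (\<Sum>m<n. \<Sum>i<n. B $$ (m, i) * A $$ (i, m))"
    by (subst sum.swap) (simp add: mult.commute)
  also have "\<dots> = mat_trace (B * A)"
    using assms by (auto simp: mat_trace_def index_mult_square_mat intro!: sum.cong simp del: index_mult_mat(1))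
  finally show ?thesis .
qed

text \<open>A one-sided inverse of a square matrix is two-sided, so \<open>G\<close> and
  \<open>T\<close> are similar. Then \<open>G ^\<^sub>m k = S * T ^\<^sub>m k * R\<close>, and the
  trace lets \<open>R\<close> move to the front and cancel.\<close>

lemma mat_trace_pow_conjugate:
  assumes G: "G \<in> carrier_mat n n" and S: "S \<in> carrier_mat n n"
    and R: "R \<in> carrier_mat n n" and T: "T \<in> carrier_mat n n"
    and GS: "G * S = S * T" and SR: "S * R = 1\<^sub>m n"
  shows "mat_trace (G ^\<^sub>m k) = mat_trace (T ^\<^sub>m k)"
proof -
  note assoc = assoc_mult_mat[of _ n n _ n _ n]
  have pow: "G ^\<^sub>m k * S = S * T ^\<^sub>m k" for k
  proof (induction k)
    case (Suc k)
    have "G ^\<^sub>m Suc k * S = G ^\<^sub>m k * S * T"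
      using G S T GS by (simp add: assoc)
    also have "\<dots> = S * T ^\<^sub>m Suc k"
      using S T Suc by (simp add: assoc)
    finally show ?case .
  qed (use G S T in simp)
  have RS: "R * S = 1\<^sub>m n"
    using mat_mult_left_right_inverse[OF S R SR] .
  have "G ^\<^sub>m k = G ^\<^sub>m k * (S * R)"
    using G SR by simp
  also have "\<dots> = S * T ^\<^sub>m k * R"
    using G S R pow by (simp flip: assoc)
  finally have "mat_trace (G ^\<^sub>m k) = mat_trace (R * (S * T ^\<^sub>m k))"
    using S R T by (simp add: mat_trace_mult_commute[of _ n])
  also have "R * (S * T ^\<^sub>m k) = T ^\<^sub>m k"
    using S R T RS by (simp flip: assoc)
  finally show ?thesis .
qed

lemma mat_trace_pow_lower_triangular:
  assumes T: "T \<in> carrier_mat n n"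
    and lower: "\<And>i j. i < j \<Longrightarrow> j < n \<Longrightarrow> T $$ (i, j) = 0"
  shows "mat_trace (T ^\<^sub>m k) = (\<Sum>i<n. (T $$ (i, i)) ^ k)"
proof -
  have "i \<le> j \<Longrightarrow> j < n \<Longrightarrow> (T ^\<^sub>m k) $$ (i, j) = (if i = j then (T $$ (i, i)) ^ k else 0)" for i j
  proof (induction k arbitrary: i j)
    case (Suc k)
    have "(T ^\<^sub>m Suc k) $$ (i, j) = (\<Sum>m<n. (T ^\<^sub>m k) $$ (i, m) * T $$ (m, j))"
      using Suc.prems T index_mult_square_mat[of "T ^\<^sub>m k" n T i j] by simp
    also have "\<dots> = (\<Sum>m<n. if m = j then (T ^\<^sub>m k) $$ (i, j) * T $$ (j, j) else 0)"
    proof (rule sum.cong, goal_cases)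
      case (2 m)
      \<comment> \<open>For \<open>m < j\<close> the factor \<open>T $$ (m, j)\<close> lies above
        the diagonal; for \<open>j < m\<close> the entry \<open>(i, m)\<close> of the power does,
        since \<open>i \<le> j\<close>. Only \<open>m = j\<close> survives.\<close>
      consider "m < j" "m < i" | "m < j" "i \<le> m" | "m = j" | "j < m" by linarith
      then show ?case
        using 2 Suc.prems Suc.IH[of i m] lower[of m j] by cases auto
    qed simp
    also have "\<dots> = (T ^\<^sub>m k) $$ (i, j) * T $$ (j, j)"
      using Suc.prems by simp
    finally show ?case
      using Suc.prems Suc.IH[of i j] by auto
  qed (use T in auto)
  then show ?thesis
    using T by (simp add: mat_trace_def)
qed

lemma sum_count_list:
  fixes g :: "'a \<Rightarrow> 'b :: semiring_1"
  assumes "finite S" "set xs \<subseteq> S"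
  shows "(\<Sum>x\<in>S. of_nat (count_list xs x) * g x) = (\<Sum>x\<leftarrow>xs. g x)"
  using assms(2)
proof (induction xs)
  case (Cons y xs)
  have "(\<Sum>x\<in>S. of_nat (count_list (y # xs) x) * g x)
      = (\<Sum>x\<in>S. (if x = y then g x else 0) + of_nat (count_list xs x) * g x)"
    by (rule sum.cong) (auto simp: algebra_simps)
  also have "\<dots> = g y + (\<Sum>x\<leftarrow>xs. g x)"
    using assms(1) Cons by (simp add: sum.distrib)
  finally show ?case by simp
qed simp

text \<open>One enumeration of the roots with multiplicity serves both purposes: it gives the
  factorization behind the Newton basis, and it turns sums weighted by multiplicity, as in the zero
  density, into plain sums.\<close>

lemma monic_poly_roots:
  fixes p :: "complex poly"
  assumes "lead_coeff p = 1" "degree p = n"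
  obtains a where "\<And>z. poly p z = (\<Prod>i<n. z - a i)"
    "\<And>g :: complex \<Rightarrow> complex. (\<Sum>z | poly p z = 0. of_nat (Polynomial.order z p) * g z) = (\<Sum>i<n. g (a i))"
proof -
  obtain as where as: "mset as = proots p"
    using ex_mset by blast
  have len: "length as = n"
    using size_proots_complex[of p] assms by (simp flip: as)
  have p: "p = (\<Prod>x\<leftarrow>as. [:-x, 1:])"
    using complex_poly_decompose_multiset[of p] assms
    by (simp flip: as prod_mset_prod_list mset_map)
  have "poly p z = (\<Prod>i<n. z - as ! i)" for z
    using len by (simp add: p poly_prod prod.list_conv_set_nth atLeast0LessThan)
  moreover have "(\<Sum>z | poly p z = 0. of_nat (Polynomial.order z p) * g z) = (\<Sum>i<n. g (as ! i))"
    for g :: "complex \<Rightarrow> complex"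
  proof -
    have "p \<noteq> 0" using assms by auto
    then have "(\<Sum>z | poly p z = 0. of_nat (Polynomial.order z p) * g z)
        = (\<Sum>z\<in>set as. of_nat (count_list as z) * g z)"
      by (intro sum.cong) (auto simp: count_mset as simp flip: set_mset_mset count_mset)
    also have "\<dots> = (\<Sum>x\<leftarrow>as. g x)"
      by (rule sum_count_list) auto
    also have "\<dots> = (\<Sum>i<n. g (as ! i))"
      by (simp add: sum_list_sum_nth atLeast0LessThan len)
    finally show ?thesis .
  qed
  ultimately show thesis using that by blast
qed

lemma norm_le_1_of_sum_squares:
  fixes x :: "nat \<Rightarrow> complex"
  assumes "(\<Sum>i<n. (cmod (x i))\<^sup>2) \<le> 1" "j < n"
  shows "cmod (x j) \<le> 1"
proof -
  have "(cmod (x j))\<^sup>2 \<le> (\<Sum>i<n. (cmod (x i))\<^sup>2)"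
    by (rule member_le_sum) (use assms in auto)
  then show ?thesis
    using assms(1) abs_square_le_1[of "cmod (x j)"] by simp
qed

subsection \<open>Linear spans of functions on the unit circle\<close>

text \<open>Equality is required on the circle only, where the measure lives. Functions with
  negative powers of z may thus be compared without regard to their values at 0.\<close>

definition circle_span :: "(nat \<Rightarrow> complex \<Rightarrow> complex) \<Rightarrow> nat \<Rightarrow> (complex \<Rightarrow> complex) set" where
  "circle_span g n = {f. \<exists>c. \<forall>z\<in>sphere 0 1. f z = (\<Sum>i<n. c i * g i z)}"

lemma circle_spanI:
  assumes "\<And>z. z \<in> sphere 0 1 \<Longrightarrow> f z = (\<Sum>i<n. c i * g i z)"
  shows "f \<in> circle_span g n"
  using assms by (auto simp: circle_span_def)

lemma circle_spanE:
  assumes "f \<in> circle_span g n"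
  obtains c where "\<And>z. z \<in> sphere 0 1 \<Longrightarrow> f z = (\<Sum>i<n. c i * g i z)"
  using assms by (auto simp: circle_span_def)

lemma circle_span_cong:
  assumes "f \<in> circle_span g n" "\<And>z. z \<in> sphere 0 1 \<Longrightarrow> f z = f' z"
  shows "f' \<in> circle_span g n"
  using assms by (auto simp: circle_span_def)

lemma circle_span_base:
  assumes "i < n"
  shows "g i \<in> circle_span g n"
proof (rule circle_spanI)
  show "g i z = (\<Sum>j<n. (if j = i then 1 else 0) * g j z)" for z
    using assms by (subst sum.cong[OF refl, of _ _ "\<lambda>j. if j = i then g j z else 0"]) auto
qed

lemma circle_span_lincomb:
  assumes "\<And>i. i < m \<Longrightarrow> f i \<in> circle_span g n"
  shows "(\<lambda>z. \<Sum>i<m. d i * f i z) \<in> circle_span g n"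
proof -
  have "\<forall>i. \<exists>c. i < m \<longrightarrow> (\<forall>z\<in>sphere 0 1. f i z = (\<Sum>j<n. c j * g j z))"
    using assms by (auto simp: circle_span_def)
  then obtain c where c: "\<And>i z. i < m \<Longrightarrow> z \<in> sphere 0 1 \<Longrightarrow> f i z = (\<Sum>j<n. c i j * g j z)"
    by metis
  show ?thesis
  proof (rule circle_spanI)
    fix z :: complex assume z: "z \<in> sphere 0 1"
    have "(\<Sum>i<m. d i * f i z) = (\<Sum>i<m. \<Sum>j<n. d i * c i j * g j z)"
      using z by (simp add: c sum_distrib_left mult.assoc)
    also have "\<dots> = (\<Sum>j<n. (\<Sum>i<m. d i * c i j) * g j z)"
      by (subst sum.swap) (simp add: sum_distrib_right)
    finally show "(\<Sum>i<m. d i * f i z) = (\<Sum>j<n. (\<Sum>i<m. d i * c i j) * g j z)" .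
  qed
qed

lemma circle_span_lincomb2:
  assumes "f \<in> circle_span g n" "h \<in> circle_span g n"
  shows "(\<lambda>z. c * f z + d * h z) \<in> circle_span g n"
proof -
  have "(\<lambda>z. \<Sum>i<2. (if i = (0::nat) then c else d) * (if i = 0 then f else h) z) \<in> circle_span g n"
    by (rule circle_span_lincomb) (use assms in auto)
  then show ?thesis by (simp add: numeral_2_eq_2)
qed

lemma circle_span_trans:
  assumes "f \<in> circle_span e m" "\<And>i. i < m \<Longrightarrow> e i \<in> circle_span g n"
  shows "f \<in> circle_span g n"
proof -
  obtain c where c: "\<And>z. z \<in> sphere 0 1 \<Longrightarrow> f z = (\<Sum>i<m. c i * e i z)"
    using circle_spanE[OF assms(1)] by blast
  have "(\<lambda>z. \<Sum>i<m. c i * e i z) \<in> circle_span g n"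
    by (rule circle_span_lincomb) (use assms in auto)
  then show ?thesis
    by (rule circle_span_cong) (simp add: c)
qed

lemma circle_span_mono:
  assumes "f \<in> circle_span g m" "m \<le> n"
  shows "f \<in> circle_span g n"
  using assms(1) by (rule circle_span_trans) (use assms(2) in \<open>auto intro: circle_span_base\<close>)

lemma circle_span_mult:
  assumes "f \<in> circle_span e m"
    and "\<And>i. i < m \<Longrightarrow> (\<lambda>z. u z * e i z) \<in> circle_span g n"
  shows "(\<lambda>z. u z * f z) \<in> circle_span g n"
proof -
  obtain c where c: "\<And>z. z \<in> sphere 0 1 \<Longrightarrow> f z = (\<Sum>i<m. c i * e i z)"
    using circle_spanE[OF assms(1)] by blast
  have "(\<lambda>z. \<Sum>i<m. c i * (u z * e i z)) \<in> circle_span g n"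
    by (rule circle_span_lincomb) (use assms in auto)
  then show ?thesis
    by (rule circle_span_cong) (simp add: c sum_distrib_left mult.left_commute)
qed

lemma continuous_on_circle_span:
  assumes "f \<in> circle_span g n" "\<And>i. i < n \<Longrightarrow> continuous_on (sphere 0 1) (g i)"
  shows "continuous_on (sphere 0 1) f"
proof -
  obtain c where c: "\<And>z. z \<in> sphere 0 1 \<Longrightarrow> f z = (\<Sum>i<n. c i * g i z)"
    using circle_spanE[OF assms(1)] by blast
  have "continuous_on (sphere 0 1) (\<lambda>z. \<Sum>i<n. c i * g i z)"
    by (intro continuous_intros) (use assms in auto)
  then show ?thesis
    by (subst continuous_on_cong[OF refl c])
qed

text \<open>The condition is on coefficients rather than on the degree, so that it also makes sense
  for \<open>n = 0\<close>, where it forces \<open>p = 0\<close>.\<close>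

lemma poly_in_circle_span:
  assumes "\<And>i. i \<ge> n \<Longrightarrow> coeff p i = 0"
  shows "poly p \<in> circle_span (\<lambda>i z. z ^ i) n"
proof (rule circle_spanI)
  fix z
  have "poly p z = (\<Sum>i\<le>max n (degree p). coeff p i * z ^ i)"
    unfolding poly_altdef by (rule sum.mono_neutral_left) (auto simp: coeff_eq_0)
  also have "\<dots> = (\<Sum>i<n. coeff p i * z ^ i)"
    by (rule sum.mono_neutral_right) (auto simp: assms)
  finally show "poly p z = (\<Sum>i<n. coeff p i * z ^ i)" .
qed

subsection \<open>The inner product of a nontrivial measure on the unit circle\<close>

locale circle_measure =
  fixes M :: "complex measure"
  assumes nontrivial: "nontrivial_circle_measure M"
begin

sublocale prob_space M
  using nontrivial by (simp add: nontrivial_circle_measure_def)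

lemma sets_M: "sets M = sets (restrict_space borel (sphere 0 1))"
  using nontrivial by (simp add: nontrivial_circle_measure_def)

lemma space_M [simp]: "space M = sphere 0 1"
  using sets_eq_imp_space_eq[OF sets_M] by (simp add: space_restrict_space)

lemma continuous_measurable:
  fixes f :: "complex \<Rightarrow> 'b :: topological_space"
  assumes "continuous_on (sphere 0 1) f"
  shows "f \<in> borel_measurable M"
  using borel_measurable_continuous_on_restrict[OF assms] measurable_cong_sets[OF sets_M refl] by blast

text \<open>A continuous function on the compact circle is bounded and the measure is finite, so
  continuity can serve below as the integrability condition.\<close>

lemma continuous_integrable:
  fixes f :: "complex \<Rightarrow> 'b :: {banach, second_countable_topology}"
  assumes "continuous_on (sphere 0 1) f"
  shows "integrable M f"
proof -
  have "bounded (f ` sphere 0 1)"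
    using assms by (intro compact_imp_bounded compact_continuous_image) auto
  then obtain B where "\<And>z. z \<in> sphere 0 1 \<Longrightarrow> norm (f z) \<le> B"
    unfolding bounded_iff by blast
  then show ?thesis
    using continuous_measurable[OF assms]
    by (intro integrable_const_bound[where B = B]) (auto intro!: AE_I2)
qed

lemma inner_cong:
  assumes "\<And>z. z \<in> sphere 0 1 \<Longrightarrow> f z = f' z" "\<And>z. z \<in> sphere 0 1 \<Longrightarrow> g z = g' z"
  shows "L2_inner M f g = L2_inner M f' g'"
  unfolding L2_inner_def by (rule Bochner_Integration.integral_cong) (use assms in auto)

lemma inner_commute: "cnj (L2_inner M f g) = L2_inner M g f"
  unfolding L2_inner_def by (simp add: mult.commute flip: Bochner_Integration.integral_cnj)

lemma inner_lincomb_right: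
  assumes "\<And>z. z \<in> sphere 0 1 \<Longrightarrow> f z = (\<Sum>i<n. c i * g i z)"
    and "continuous_on (sphere 0 1) h" "\<And>i. i < n \<Longrightarrow> continuous_on (sphere 0 1) (g i)"
  shows "L2_inner M h f = (\<Sum>i<n. c i * L2_inner M h (g i))"
proof -
  have "L2_inner M h f = (LINT z|M. (\<Sum>i<n. c i * (cnj (h z) * g i z)))"
    unfolding L2_inner_def
    by (rule Bochner_Integration.integral_cong) (auto simp: assms(1) sum_distrib_left mult_ac)
  also have "\<dots> = (\<Sum>i<n. LINT z|M. c i * (cnj (h z) * g i z))"
    by (rule Bochner_Integration.integral_sum)
      (intro continuous_integrable continuous_intros, use assms in auto)
  finally show ?thesis by (simp add: L2_inner_def)
qed

lemma inner_lincomb2_right: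
  assumes "continuous_on (sphere 0 1) h" "continuous_on (sphere 0 1) f" "continuous_on (sphere 0 1) g"
  shows "L2_inner M h (\<lambda>z. c * f z + d * g z) = c * L2_inner M h f + d * L2_inner M h g"
proof -
  have "L2_inner M h (\<lambda>z. c * f z + d * g z)
      = (\<Sum>i<2. (if i = (0::nat) then c else d) * L2_inner M h (if i = 0 then f else g))"
    by (rule inner_lincomb_right) (use assms in \<open>auto simp: numeral_2_eq_2\<close>)
  then show ?thesis by (simp add: numeral_2_eq_2)
qed

lemma inner_circle_span_eq_0:
  assumes "f \<in> circle_span g n" "\<And>i. i < n \<Longrightarrow> L2_inner M h (g i) = 0"
    and "continuous_on (sphere 0 1) h" "\<And>i. i < n \<Longrightarrow> continuous_on (sphere 0 1) (g i)"
  shows "L2_inner M h f = 0"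
proof -
  obtain c where c: "\<And>z. z \<in> sphere 0 1 \<Longrightarrow> f z = (\<Sum>i<n. c i * g i z)"
    using circle_spanE[OF assms(1)] by blast
  then show ?thesis
    using inner_lincomb_right[OF c] assms by simp
qed

lemma inner_self: "L2_inner M f f = of_real ((L2_nrm M f)\<^sup>2)"
proof -
  have "L2_inner M f f = (LINT z|M. complex_of_real ((cmod (f z))\<^sup>2))"
    unfolding L2_inner_def
    by (rule Bochner_Integration.integral_cong) (simp_all only: mult.commute complex_norm_square)
  then show ?thesis
    by (simp add: L2_nrm_def del: of_real_power)
qed

lemma nrm_cong:
  assumes "\<And>z. z \<in> sphere 0 1 \<Longrightarrow> cmod (f z) = cmod (g z)"
  shows "L2_nrm M f = L2_nrm M g"
  unfolding L2_nrm_def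
  by (rule arg_cong[where f = sqrt], rule Bochner_Integration.integral_cong) (use assms in auto)

text \<open>This is where the measure not being a finite combination of point masses enters: if a
  nonzero polynomial had norm 0, the measure would be concentrated on its finitely many zeros on the
  circle.\<close>

lemma nrm_poly_eq_0_imp:
  assumes "L2_nrm M (poly p) = 0"
  shows "p = 0"
proof (rule ccontr)
  assume "p \<noteq> 0"
  define S where "S = {z \<in> sphere 0 1. poly p z = 0}"
  have finS: "finite S"
    using poly_roots_finite[OF \<open>p \<noteq> 0\<close>] by (auto simp: S_def)
  have "(LINT z|M. (cmod (poly p z))\<^sup>2) = 0"
    using assms by (simp add: L2_nrm_def)
  moreover have "integrable M (\<lambda>z. (cmod (poly p z))\<^sup>2)"
    by (intro continuous_integrable continuous_intros)
  ultimately have "AE z in M. (cmod (poly p z))\<^sup>2 = 0"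
    by (subst (asm) integral_nonneg_eq_0_iff_AE) auto
  then have ae: "AE z in M. z \<in> S"
    by (rule AE_mp) (auto intro!: AE_I2 simp: S_def)
  have single: "{s} \<in> sets M" if "s \<in> S" for s
    using that by (auto simp: sets_M sets_restrict_space S_def intro!: image_eqI[of _ _ "{s}"])
  have "measure M A = (\<Sum>s\<in>S. measure M {s} * indicator A s)" if A: "A \<in> sets M" for A
  proof -
    have "measure M A = measure M (A \<inter> S)"
    proof (rule finite_measure_eq_AE)
      show "A \<inter> S \<in> sets M"
        using A finS single sets.finite_UN[of S "\<lambda>s. {s}" M] by auto
    qed (use A ae in auto)
    also have "\<dots> = (\<Sum>s\<in>A \<inter> S. measure M {s})"
      by (rule finite_measure_eq_sum_singleton) (use finS single in auto)
    also have "\<dots> = (\<Sum>s\<in>S. measure M {s} * indicator A s)"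
      using finS by (simp add: indicator_def sum.If_cases Int_commute if_distrib cong: if_cong)
    finally show ?thesis .
  qed
  then show False
    using nontrivial finS by (auto simp: nontrivial_circle_measure_def)
qed

text \<open>Continuity is included so that the linearity rules for \<open>L2_inner\<close> apply to
  such families without separate integrability conditions.\<close>

definition orthonormal :: "(nat \<Rightarrow> complex \<Rightarrow> complex) \<Rightarrow> nat \<Rightarrow> bool" where
  "orthonormal e n \<longleftrightarrow> (\<forall>i<n. continuous_on (sphere 0 1) (e i)) \<and>
     (\<forall>i<n. \<forall>j<n. L2_inner M (e i) (e j) = (if i = j then 1 else 0))"

lemma orthonormal_continuous: "orthonormal e n \<Longrightarrow> i < n \<Longrightarrow> continuous_on (sphere 0 1) (e i)"
  by (simp add: orthonormal_def)

lemma orthonormal_inner: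
  "orthonormal e n \<Longrightarrow> i < n \<Longrightarrow> j < n \<Longrightarrow> L2_inner M (e i) (e j) = (if i = j then 1 else 0)"
  by (simp add: orthonormal_def)

lemma orthonormal_expansion:
  assumes "orthonormal e n" "f \<in> circle_span e n" "z \<in> sphere 0 1"
  shows "f z = (\<Sum>i<n. L2_inner M (e i) f * e i z)"
proof -
  obtain c where c: "\<And>z. z \<in> sphere 0 1 \<Longrightarrow> f z = (\<Sum>i<n. c i * e i z)"
    using circle_spanE[OF assms(2)] by blast
  have "L2_inner M (e i) f = c i" if "i < n" for i
  proof -
    have "L2_inner M (e i) f = (\<Sum>j<n. c j * L2_inner M (e i) (e j))"
      using c by (rule inner_lincomb_right) (use assms that orthonormal_continuous in auto)
    also have "\<dots> = (\<Sum>j<n. if j = i then c j else 0)"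
      by (rule sum.cong) (use assms(1) that in \<open>auto simp: orthonormal_inner\<close>)
    finally show ?thesis using that by simp
  qed
  then show ?thesis
    using c[OF assms(3)] by simp
qed

text \<open>Because \<open>f\<close> lies in the span of \<open>e\<close>, inserting the projection
  onto that span changes nothing. For \<open>u z = z\<close> the right-hand side is a row of the
  compression acting on the coordinates of \<open>f\<close>.\<close>

lemma parseval_multiplication:
  assumes "orthonormal e n" "f \<in> circle_span e n"
    and "continuous_on (sphere 0 1) h" "continuous_on (sphere 0 1) u"
  shows "L2_inner M h (\<lambda>z. u z * f z) = (\<Sum>i<n. L2_inner M h (\<lambda>z. u z * e i z) * L2_inner M (e i) f)"
proof -
  have "L2_inner M h (\<lambda>z. u z * f z) = (\<Sum>i<n. L2_inner M (e i) f * L2_inner M h (\<lambda>z. u z * e i z))"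
  proof (rule inner_lincomb_right)
    show "u z * f z = (\<Sum>i<n. L2_inner M (e i) f * (u z * e i z))" if "z \<in> sphere 0 1" for z
      by (subst orthonormal_expansion[OF assms(1,2) that]) (simp add: sum_distrib_left mult_ac)
  qed (use assms orthonormal_continuous in \<open>auto intro!: continuous_intros\<close>)
  then show ?thesis by (simp add: mult.commute)
qed

text \<open>The residual \<open>r\<close> of the projection \<open>p\<close> is orthogonal to every
  \<open>e i\<close>, hence to \<open>p\<close>. Its squared norm is therefore the difference of the
  two sides, and it is nonnegative.\<close>

lemma bessel:
  assumes e: "orthonormal e n" and f: "continuous_on (sphere 0 1) f"
  shows "(\<Sum>i<n. (cmod (L2_inner M (e i) f))\<^sup>2) \<le> (L2_nrm M f)\<^sup>2"
proof -
  define p where "p z = (\<Sum>i<n. L2_inner M (e i) f * e i z)" for z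
  have p: "p \<in> circle_span e n"
    unfolding p_def by (rule circle_spanI) simp
  have cp: "continuous_on (sphere 0 1) p"
    using p by (rule continuous_on_circle_span) (use e orthonormal_continuous in auto)
  define r where "r z = 1 * f z + (-1) * p z" for z
  have cr: "continuous_on (sphere 0 1) r"
    unfolding r_def by (intro continuous_intros f cp)
  have inner_p: "L2_inner M h p = (\<Sum>i<n. L2_inner M (e i) f * L2_inner M h (e i))"
    if "continuous_on (sphere 0 1) h" for h
    by (rule inner_lincomb_right) (use that e orthonormal_continuous in \<open>auto simp: p_def\<close>)
  have inner_r: "L2_inner M h r = L2_inner M h f - L2_inner M h p"
    if "continuous_on (sphere 0 1) h" for h
    unfolding r_def using inner_lincomb2_right[OF that f cp, of 1 "-1"] by simp
  have "L2_inner M (e i) r = 0" if "i < n" for i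
  proof -
    have "(\<Sum>j<n. L2_inner M (e j) f * L2_inner M (e i) (e j)) = (\<Sum>j<n. if j = i then L2_inner M (e i) f else 0)"
      by (rule sum.cong) (use that e in \<open>auto simp: orthonormal_inner\<close>)
    then have "L2_inner M (e i) p = L2_inner M (e i) f"
      using that e by (simp add: inner_p orthonormal_continuous)
    then show ?thesis
      using that e by (simp add: inner_r orthonormal_continuous)
  qed
  then have "L2_inner M r (e i) = 0" if "i < n" for i
    using that inner_commute[of "e i" r] by simp
  then have "L2_inner M r p = 0"
    by (simp add: inner_p cr)
  moreover have "L2_inner M r f = L2_inner M f f - L2_inner M p f"
    using arg_cong[OF inner_r[OF f], of cnj] by (simp add: inner_commute)
  ultimately have "L2_inner M r r = L2_inner M f f - L2_inner M p f"
    by (simp add: inner_r cr)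
  moreover have "L2_inner M p f = of_real (\<Sum>i<n. (cmod (L2_inner M (e i) f))\<^sup>2)"
  proof -
    have "L2_inner M p f = cnj (\<Sum>i<n. L2_inner M (e i) f * cnj (L2_inner M (e i) f))"
      using inner_p[OF f] using inner_commute[of f p] by (simp add: inner_commute)
    then show ?thesis
      by (simp add: complex_norm_square mult.commute del: of_real_power)
  qed
  ultimately have "complex_of_real ((L2_nrm M r)\<^sup>2)
      = of_real ((L2_nrm M f)\<^sup>2 - (\<Sum>i<n. (cmod (L2_inner M (e i) f))\<^sup>2))"
    by (simp only: inner_self of_real_diff)
  then have "(L2_nrm M f)\<^sup>2 - (\<Sum>i<n. (cmod (L2_inner M (e i) f))\<^sup>2) = (L2_nrm M r)\<^sup>2"
    by (simp only: of_real_eq_iff)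
  then show ?thesis
    using zero_le_power2[of "L2_nrm M r"] by linarith
qed

subsection \<open>Gram-Schmidt and orthogonal polynomials\<close>

text \<open>Independence is stated in the L2 sense: no \<open>g n\<close> has distance 0 from a
  combination of its predecessors. This is exactly what keeps the normalizing denominators away from
  0.\<close>

lemma gram_schmidt_L2_props:
  fixes g :: "nat \<Rightarrow> complex \<Rightarrow> complex"
  assumes cont: "\<And>n. continuous_on (sphere 0 1) (g n)"
    and indep: "\<And>n f. f \<in> circle_span g n \<Longrightarrow> L2_nrm M (\<lambda>z. g n z - f z) \<noteq> 0"
  defines "e \<equiv> gram_schmidt_L2 M g"
  shows gram_schmidt_L2_orthonormal: "orthonormal e n"
    and gram_schmidt_L2_in_span: "e n \<in> circle_span g (Suc n)"
    and in_span_gram_schmidt_L2: "g n \<in> circle_span e (Suc n)"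
proof -
  define h where "h n z = g n z - (\<Sum>m<n. L2_inner M (e m) (g n) * e m z)" for n z
  have e_h: "e n = (\<lambda>z. h n z / of_real (L2_nrm M (h n)))" for n
    unfolding e_def by (subst gram_schmidt_L2.simps) (simp add: L2_normalize_def h_def[abs_def] e_def)
  \<comment> \<open>The nonvanishing norm is part of the invariant because it is also needed at the
    end, to recover \<open>g n\<close> from \<open>e n\<close>.\<close>
  have main: "continuous_on (sphere 0 1) (e n) \<and> e n \<in> circle_span g (Suc n) \<and>
      (\<forall>m<n. L2_inner M (e m) (e n) = 0) \<and> L2_inner M (e n) (e n) = 1 \<and> L2_nrm M (h n) \<noteq> 0" for n
  proof (induction n rule: less_induct)
    case (less n)
    have orth: "L2_inner M (e i) (e j) = (if i = j then 1 else 0)" if "i < n" "j < n" for i j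
    proof (cases i j rule: linorder_cases)
      case greater
      then show ?thesis
        using less.IH[OF that(1)] inner_commute[of "e j" "e i"] by simp
    qed (use less that in auto)
    then have on: "orthonormal e n"
      using less by (auto simp: orthonormal_def)
    define p where "p z = (\<Sum>m<n. L2_inner M (e m) (g n) * e m z)" for z
    have p_e: "p \<in> circle_span e n"
      unfolding p_def by (rule circle_spanI) simp
    \<comment> \<open>Rewriting the projection in terms of the original functions makes
      \<open>indep\<close> applicable to it.\<close>
    then have p_g: "p \<in> circle_span g n"
      by (rule circle_span_trans) (use less in \<open>auto intro!: circle_span_mono[of "e _" g "Suc _" n]\<close>)
    have cp: "continuous_on (sphere 0 1) p"
      using p_g cont by (rule continuous_on_circle_span)
    have h_p: "h n = (\<lambda>z. 1 * g n z + (-1) * p z)"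
      by (simp add: h_def p_def fun_eq_iff)
    have nz: "L2_nrm M (h n) \<noteq> 0"
      using indep[OF p_g] by (simp add: h_p)
    have ch: "continuous_on (sphere 0 1) (h n)"
      unfolding h_p by (intro continuous_intros cont cp)
    have ce: "continuous_on (sphere 0 1) (e n)"
      unfolding e_h by (intro continuous_intros ch) (use nz in auto)
    \<comment> \<open>The summand with coefficient 0 brings a mere rescaling into the shape of the
      rules for two-term combinations.\<close>
    have e_scale: "e n = (\<lambda>z. inverse (of_real (L2_nrm M (h n))) * h n z + 0 * h n z)"
      by (simp add: e_h[of n] fun_eq_iff divide_inverse mult.commute)
    have inner_e: "L2_inner M f (e n) = L2_inner M f (h n) / of_real (L2_nrm M (h n))"
      if "continuous_on (sphere 0 1) f" for f
      by (subst e_scale, subst inner_lincomb2_right)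
        (use that ch in \<open>auto simp: divide_inverse mult.commute\<close>)
    have "e n \<in> circle_span g (Suc n)"
      unfolding e_scale h_p
      by (intro circle_span_lincomb2 circle_span_base circle_span_mono[OF p_g]) auto
    moreover have "L2_inner M (e m) (e n) = 0" if "m < n" for m
    proof -
      have cm: "continuous_on (sphere 0 1) (e m)"
        using less that by blast
      have "L2_inner M (e m) p = (\<Sum>j<n. L2_inner M (e j) (g n) * L2_inner M (e m) (e j))"
        by (rule inner_lincomb_right) (use less that in \<open>auto simp: p_def\<close>)
      also have "\<dots> = (\<Sum>j<n. if j = m then L2_inner M (e m) (g n) else 0)"
        by (rule sum.cong) (use that orth in auto)
      also have "\<dots> = L2_inner M (e m) (g n)"
        using that by simp
      finally have "L2_inner M (e m) (h n) = 0"
        unfolding h_p by (subst inner_lincomb2_right) (use cm cont cp in auto)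
      then show ?thesis
        using inner_e[OF cm] by simp
    qed
    moreover have "L2_inner M (e n) (e n) = 1"
    proof -
      have "L2_inner M (e n) (h n) = cnj (L2_inner M (h n) (e n))"
        by (simp add: inner_commute)
      also have "\<dots> = of_real ((L2_nrm M (h n))\<^sup>2 / L2_nrm M (h n))"
        by (simp add: inner_e ch inner_self del: of_real_power)
      finally show ?thesis
        using nz by (simp add: inner_e ce power2_eq_square)
    qed
    ultimately show ?case
      using ce nz by blast
  qed
  have orth: "L2_inner M (e i) (e j) = (if i = j then 1 else 0)" for i j
  proof (cases i j rule: linorder_cases)
    case greater
    then show ?thesis
      using main[of i] inner_commute[of "e j" "e i"] by simp
  qed (use main in auto)
  then show "orthonormal e n"
    using main by (simp add: orthonormal_def)
  show "e n \<in> circle_span g (Suc n)"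
    using main by blast
  show "g n \<in> circle_span e (Suc n)"
  proof (rule circle_spanI)
    fix z
    have "g n z = h n z + (\<Sum>m<n. L2_inner M (e m) (g n) * e m z)"
      by (simp add: h_def)
    also have "h n z = of_real (L2_nrm M (h n)) * e n z"
      using main[of n] by (simp add: e_h[of n])
    finally show "g n z = (\<Sum>i<Suc n. (if i = n then of_real (L2_nrm M (h n)) else L2_inner M (e i) (g n)) * e i z)"
      by simp
  qed
qed

text \<open>Multiplying by a high power of z leaves the modulus on the circle unchanged and turns
  the Laurent polynomial into a polynomial. Norm 0 would make that polynomial 0, although
  injectivity of \<open>s\<close> leaves the coefficient 1 at \<open>t n\<close>.\<close>

lemma powi_independent:
  fixes s :: "nat \<Rightarrow> int"
  assumes "inj s" and f: "f \<in> circle_span (\<lambda>i z. z powi s i) n"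
  shows "L2_nrm M (\<lambda>z. z powi s n - f z) \<noteq> 0"
proof
  assume nrm: "L2_nrm M (\<lambda>z. z powi s n - f z) = 0"
  obtain c where c: "\<And>z. z \<in> sphere 0 1 \<Longrightarrow> f z = (\<Sum>i<n. c i * z powi s i)"
    using circle_spanE[OF f] by blast
  \<comment> \<open>\<open>L\<close> dominates every \<open>\<bar>s i\<bar>\<close> with
    \<open>i \<le> n\<close>, so the shifted exponents are nonnegative and \<open>nat\<close>
    truncates nothing.\<close>
  define L where "L = (\<Sum>i\<le>n. nat \<bar>s i\<bar>)"
  define t where "t i = nat (int L + s i)" for i
  have t: "int (t i) = int L + s i" if "i \<le> n" for i
  proof -
    have "nat \<bar>s i\<bar> \<le> L"
      unfolding L_def by (rule member_le_sum) (use that in auto)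
    then show ?thesis by (simp add: t_def)
  qed
  then have t_eq: "t i = t n \<longleftrightarrow> i = n" if "i \<le> n" for i
    using t[OF that] t[of n] injD[OF \<open>inj s\<close>, of i n] by auto
  have shift: "z ^ t i = z ^ L * z powi s i" if "i \<le> n" "z \<noteq> 0" for i and z :: complex
    using that by (simp add: t power_int_add flip: power_int_of_nat)
  define p where "p = monom 1 (t n) - (\<Sum>i<n. monom (c i) (t i))"
  have "cmod (poly p z) = cmod (z powi s n - f z)" if z: "z \<in> sphere 0 1" for z
  proof -
    have "z \<noteq> 0" using z by auto
    have "poly p z = z ^ t n - (\<Sum>i<n. c i * z ^ t i)"
      by (simp add: p_def poly_sum poly_monom)
    also have "\<dots> = z ^ L * (z powi s n - f z)"
      using \<open>z \<noteq> 0\<close> by (simp add: shift c[OF z] right_diff_distrib sum_distrib_left mult.left_commute)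
    finally show ?thesis
      using z by (simp add: norm_mult norm_power)
  qed
  then have "p = 0"
    using nrm nrm_cong[of "poly p" "\<lambda>z. z powi s n - f z"] by (intro nrm_poly_eq_0_imp) simp
  moreover have "coeff p (t n) = 1"
    by (simp add: p_def coeff_sum t_eq)
  ultimately show False by simp
qed

text \<open>A Gram-Schmidt version of the orthonormal polynomials, so that the general results above
  apply; \<open>orthonormal_OP_eq\<close> identifies it on the circle with
  \<open>orthonormal_OP M\<close>.\<close>

definition OP :: "nat \<Rightarrow> complex \<Rightarrow> complex" where
  "OP = gram_schmidt_L2 M (\<lambda>n z. z ^ n)"

lemma power_independent:
  assumes "f \<in> circle_span (\<lambda>i z. z ^ i) n"
  shows "L2_nrm M (\<lambda>z. z ^ n - f z) \<noteq> 0"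
  using powi_independent[of int f n] assms by (simp add: power_int_of_nat)

lemma continuous_power: "continuous_on (sphere 0 1) (\<lambda>z :: complex. z ^ n)"
  by (intro continuous_intros)

lemma OP_orthonormal: "orthonormal OP n"
  unfolding OP_def by (rule gram_schmidt_L2_orthonormal[OF continuous_power power_independent])

lemma OP_in_span: "OP n \<in> circle_span (\<lambda>i z. z ^ i) (Suc n)"
  unfolding OP_def by (rule gram_schmidt_L2_in_span[OF continuous_power power_independent])

lemma power_in_span_OP: "(\<lambda>z. z ^ n) \<in> circle_span OP (Suc n)"
  unfolding OP_def by (rule in_span_gram_schmidt_L2[OF continuous_power power_independent])

lemma inner_power_OP:
  assumes "j < n"
  shows "L2_inner M (\<lambda>z. z ^ j) (OP n) = 0"
proof -
  have "L2_inner M (OP n) (\<lambda>z. z ^ j) = 0"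
  proof (rule inner_circle_span_eq_0[OF power_in_span_OP])
    show "L2_inner M (OP n) (OP i) = 0" if "i < Suc j" for i
      using orthonormal_inner[OF OP_orthonormal[of "Suc n"], of n i] that assms by simp
  qed (use orthonormal_continuous[OF OP_orthonormal] in auto)
  then show ?thesis
    using inner_commute[of "OP n" "\<lambda>z. z ^ j"] by simp
qed

text \<open>Before normalization, the Gram-Schmidt vector is z^n minus a combination of lower
  powers, hence a monic polynomial on the circle. It will be the witness for the definite
  description in \<open>monic_OP\<close>.\<close>

lemma monic_multiple_of_OP:
  obtains P where "degree P = n" "lead_coeff P = 1" "L2_nrm M (poly P) \<noteq> 0"
    "\<And>z. z \<in> sphere 0 1 \<Longrightarrow> poly P z = of_real (L2_nrm M (poly P)) * OP n z"
proof -
  define p where "p z = (\<Sum>m<n. L2_inner M (OP m) (\<lambda>z. z ^ n) * OP m z)" for z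
  define h where "h z = z ^ n - p z" for z
  have OP_h: "OP n = (\<lambda>z. h z / of_real (L2_nrm M h))"
    unfolding OP_def by (subst gram_schmidt_L2.simps)
      (simp add: L2_normalize_def h_def[abs_def] p_def OP_def)
  have "p \<in> circle_span OP n"
    unfolding p_def by (rule circle_spanI) simp
  then have p_pow: "p \<in> circle_span (\<lambda>i z. z ^ i) n"
    by (rule circle_span_trans) (auto intro!: circle_span_mono[OF OP_in_span])
  then have nz: "L2_nrm M h \<noteq> 0"
    unfolding h_def[abs_def] by (rule power_independent)
  obtain c where c: "\<And>z. z \<in> sphere 0 1 \<Longrightarrow> p z = (\<Sum>i<n. c i * z ^ i)"
    using circle_spanE[OF p_pow] by blast
  define P where "P = monom 1 n - (\<Sum>i<n. monom (c i) i)"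
  have coeff_P: "coeff P i = (if i = n then 1 else if i < n then - c i else 0)" for i
    by (simp add: P_def coeff_sum)
  have P_h: "poly P z = h z" if "z \<in> sphere 0 1" for z
    using that by (simp add: P_def h_def c poly_sum poly_monom)
  then have nrm_P: "L2_nrm M (poly P) = L2_nrm M h"
    by (intro nrm_cong) simp
  have deg: "degree P = n"
    by (rule antisym[OF degree_le le_degree]) (auto simp: coeff_P)
  show thesis
  proof (rule that[OF deg])
    show "lead_coeff P = 1"
      using deg by (simp add: coeff_P)
    show "L2_nrm M (poly P) \<noteq> 0"
      using nz by (simp add: nrm_P)
    show "poly P z = of_real (L2_nrm M (poly P)) * OP n z" if "z \<in> sphere 0 1" for z
      using nz that by (simp add: nrm_P P_h OP_h)
  qed
qed

text \<open>The leading terms cancel in the difference, which is then a combination of powers below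
  \<open>n\<close> and orthogonal to all of them, hence to itself.\<close>

lemma monic_orthogonal_unique:
  assumes p: "degree p = n" "lead_coeff p = 1" "\<And>j. j < n \<Longrightarrow> L2_inner M (\<lambda>z. z ^ j) (poly p) = 0"
    and q: "degree q = n" "lead_coeff q = 1" "\<And>j. j < n \<Longrightarrow> L2_inner M (\<lambda>z. z ^ j) (poly q) = 0"
  shows "p = q"
proof -
  have r_span: "poly (p - q) \<in> circle_span (\<lambda>i z. z ^ i) n"
  proof (rule poly_in_circle_span)
    fix i assume "n \<le> i"
    then show "coeff (p - q) i = 0"
      using p q by (cases "i = n") (auto simp: coeff_eq_0)
  qed
  have "L2_inner M (poly (p - q)) (\<lambda>z. z ^ i) = 0" if "i < n" for i
  proof -
    have "L2_inner M (\<lambda>z. z ^ i) (\<lambda>z. 1 * poly p z + (-1) * poly q z) = 0"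
      by (subst inner_lincomb2_right) (use that p q in \<open>auto intro!: continuous_intros\<close>)
    then show ?thesis
      using inner_commute[of "\<lambda>z. z ^ i" "poly (p - q)"] by (simp add: poly_diff[abs_def])
  qed
  then have "L2_inner M (poly (p - q)) (poly (p - q)) = 0"
    by (intro inner_circle_span_eq_0[OF r_span]) (auto intro!: continuous_intros)
  then have "L2_nrm M (poly (p - q)) = 0"
    by (simp add: inner_self)
  then show ?thesis
    using nrm_poly_eq_0_imp by fastforce
qed

lemma monic_OP_props:
  shows degree_monic_OP: "degree (monic_OP M n) = n"
    and lead_coeff_monic_OP: "lead_coeff (monic_OP M n) = 1"
    and inner_power_monic_OP: "j < n \<Longrightarrow> L2_inner M (\<lambda>z. z ^ j) (poly (monic_OP M n)) = 0"
    and orthonormal_OP_eq: "z \<in> sphere 0 1 \<Longrightarrow> orthonormal_OP M n z = OP n z"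
proof -
  obtain P where P: "degree P = n" "lead_coeff P = 1" "L2_nrm M (poly P) \<noteq> 0"
    "\<And>z. z \<in> sphere 0 1 \<Longrightarrow> poly P z = of_real (L2_nrm M (poly P)) * OP n z"
    using monic_multiple_of_OP by blast
  have orth: "L2_inner M (\<lambda>z. z ^ j) (poly P) = 0" if "j < n" for j
  proof -
    have "L2_inner M (\<lambda>z. z ^ j) (poly P)
        = L2_inner M (\<lambda>z. z ^ j) (\<lambda>z. of_real (L2_nrm M (poly P)) * OP n z + 0 * OP n z)"
      by (rule inner_cong) (use P(4) in auto)
    also have "\<dots> = 0"
      using that orthonormal_continuous[OF OP_orthonormal lessI]
      by (subst inner_lincomb2_right) (auto simp: inner_power_OP intro!: continuous_intros)
    finally show ?thesis .
  qed
  have monic: "monic_OP M n = P"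
    unfolding monic_OP_def
  proof (rule the_equality)
    show "degree P = n \<and> lead_coeff P = 1 \<and> (\<forall>j<n. L2_inner M (\<lambda>z. z ^ j) (poly P) = 0)"
      using P orth by blast
  next
    fix q assume "degree q = n \<and> lead_coeff q = 1 \<and> (\<forall>j<n. L2_inner M (\<lambda>z. z ^ j) (poly q) = 0)"
    then show "q = P"
      using P(1,2) orth by (intro monic_orthogonal_unique[of q n P]) auto
  qed
  show "degree (monic_OP M n) = n" "lead_coeff (monic_OP M n) = 1"
    using P by (simp_all add: monic)
  show "L2_inner M (\<lambda>z. z ^ j) (poly (monic_OP M n)) = 0" if "j < n"
    using that orth by (simp add: monic)
  show "orthonormal_OP M n z = OP n z" if "z \<in> sphere 0 1"
    using P(3) P(4)[OF that] by (simp add: orthonormal_OP_def monic)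
qed

subsection \<open>Compressions of multiplication by z\<close>

text \<open>The hypotheses say that \<open>e\<close> is an orthonormal basis of z^(-l) times the
  polynomials of degree less than \<open>n\<close>. The trace does not depend on \<open>l\<close>,
  which lets the CMV and the GGT matrices be treated together.\<close>

lemma trace_pow_compression:
  assumes e: "orthonormal e n"
    and e_span: "\<And>m. m < n \<Longrightarrow> e m \<in> circle_span (\<lambda>j z. z ^ j / z ^ l) n"
    and span_e: "\<And>j. j < n \<Longrightarrow> (\<lambda>z. z ^ j / z ^ l) \<in> circle_span e n"
    and roots: "\<And>z. poly (monic_OP M n) z = (\<Prod>i<n. z - a i)"
  shows "mat_trace (mat n n (\<lambda>(i, j). L2_inner M (e i) (\<lambda>z. z * e j z)) ^\<^sub>m k) = (\<Sum>i<n. a i ^ k)"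
proof -
  define \<mu> where "\<mu> j z = z ^ j / z ^ l" for j and z :: complex
  \<comment> \<open>The Newton basis at the zeros, shifted like the space itself; \<open>w n\<close>
    is the monic orthogonal polynomial divided by z^l and lies one degree beyond the space.\<close>
  define w where "w j z = (\<Prod>i<j. z - a i) / z ^ l" for j z
  have \<mu>_Suc: "(\<lambda>z. z * \<mu> j z) = \<mu> (Suc j)" for j
    by (simp add: \<mu>_def fun_eq_iff)
  have w_Suc: "z * w j z = w (Suc j) z + a j * w j z" for j z
    by (simp add: w_def algebra_simps flip: add_divide_distrib)
  have w_\<mu>: "w j \<in> circle_span \<mu> (Suc j)" for j
  proof (induction j)
    case 0
    have "w 0 = \<mu> 0"
      by (simp add: w_def \<mu>_def fun_eq_iff)
    then show ?case
      by (simp add: circle_span_base)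
  next
    case (Suc j)
    have "(\<lambda>z. z * w j z) \<in> circle_span \<mu> (Suc (Suc j))"
      by (rule circle_span_mult[OF Suc]) (simp add: \<mu>_Suc circle_span_base)
    moreover have "w j \<in> circle_span \<mu> (Suc (Suc j))"
      by (rule circle_span_mono[OF Suc]) simp
    ultimately have "(\<lambda>z. 1 * (z * w j z) + (- a j) * w j z) \<in> circle_span \<mu> (Suc (Suc j))"
      by (rule circle_span_lincomb2)
    then show ?case
      by (simp add: w_Suc cong: if_cong)
  qed
  have \<mu>_w: "\<mu> j \<in> circle_span w (Suc j)" for j
  proof (induction j)
    case 0
    have "\<mu> 0 = w 0"
      by (simp add: w_def \<mu>_def fun_eq_iff)
    then show ?case
      by (simp add: circle_span_base)
  next
    case (Suc j)
    have "(\<lambda>z. z * \<mu> j z) \<in> circle_span w (Suc (Suc j))"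
    proof (rule circle_span_mult[OF Suc])
      fix i assume "i < Suc j"
      then have "(\<lambda>z. 1 * w (Suc i) z + a i * w i z) \<in> circle_span w (Suc (Suc j))"
        by (intro circle_span_lincomb2 circle_span_base) auto
      then show "(\<lambda>z. z * w i z) \<in> circle_span w (Suc (Suc j))"
        by (simp add: w_Suc)
    qed
    then show ?case
      by (simp only: \<mu>_Suc)
  qed
  have w_e: "w j \<in> circle_span e n" if "j < n" for j
    using w_\<mu> by (rule circle_span_trans) (use span_e that in \<open>auto simp: \<mu>_def[abs_def]\<close>)
  have e_w: "e m \<in> circle_span w n" if "m < n" for m
    using e_span[OF that, folded \<mu>_def[abs_def]]
    by (rule circle_span_trans) (auto intro!: circle_span_mono[OF \<mu>_w])
  have cont_e: "continuous_on (sphere 0 1) (e i)" if "i < n" for i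
    using e that by (rule orthonormal_continuous)
  have cont_w: "continuous_on (sphere 0 1) (w j)" for j
    unfolding w_def by (intro continuous_intros) auto
  \<comment> \<open>On the circle the factor z^(-l) can be moved to the other argument as z^l. There
    it makes \<open>e i\<close> a polynomial of degree less than \<open>n\<close>, to which the
    monic orthogonal polynomial is orthogonal.\<close>
  have inner_w_n: "L2_inner M (e i) (w n) = 0" if i: "i < n" for i
  proof -
    have "(\<lambda>z. z ^ l * e i z) \<in> circle_span (\<lambda>j z. z ^ j) n"
      using e_span[OF i]
    proof (rule circle_span_mult)
      fix j assume "j < n"
      then have "(\<lambda>z. z ^ j) \<in> circle_span (\<lambda>j z. z ^ j) n"
        by (rule circle_span_base)
      then show "(\<lambda>z. z ^ l * (z ^ j / z ^ l)) \<in> circle_span (\<lambda>j z. z ^ j) n"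
        by (rule circle_span_cong) auto
    qed
    then have "L2_inner M (poly (monic_OP M n)) (\<lambda>z. z ^ l * e i z) = 0"
    proof (rule inner_circle_span_eq_0)
      show "L2_inner M (poly (monic_OP M n)) (\<lambda>z. z ^ j) = 0" if "j < n" for j
        using inner_power_monic_OP[OF that] inner_commute[of "\<lambda>z. z ^ j" "poly (monic_OP M n)"] by simp
    qed (auto intro!: continuous_intros)
    moreover have "L2_inner M (e i) (w n) = L2_inner M (\<lambda>z. z ^ l * e i z) (poly (monic_OP M n))"
      unfolding L2_inner_def
    proof (rule Bochner_Integration.integral_cong)
      fix z assume "z \<in> space M"
      then have "z * cnj z = 1" "z \<noteq> 0"
        using complex_norm_square[of z] by auto
      then have "cnj z = inverse z"
        by (simp add: inverse_unique)
      then show "cnj (e i z) * w n z = cnj (z ^ l * e i z) * poly (monic_OP M n) z"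
        by (simp add: w_def roots field_simps)
    qed simp
    ultimately show ?thesis
      using inner_commute[of "poly (monic_OP M n)" "\<lambda>z. z ^ l * e i z"] by simp
  qed
  have "\<forall>m. \<exists>c. m < n \<longrightarrow> (\<forall>z\<in>sphere 0 1. e m z = (\<Sum>j<n. c j * w j z))"
    using e_w by (auto simp: circle_span_def)
  then obtain c where c: "\<And>m z. m < n \<Longrightarrow> z \<in> sphere 0 1 \<Longrightarrow> e m z = (\<Sum>j<n. c m j * w j z)"
    by metis
  \<comment> \<open>\<open>G\<close> is the compression in the basis \<open>e\<close>,
    \<open>S\<close> holds the coordinates of the \<open>w j\<close> in that basis, \<open>R\<close>
    those of the \<open>e m\<close> in the Newton basis, and \<open>T\<close> is the bidiagonal form
    of the compression in the Newton basis.\<close>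
  define G where "G = mat n n (\<lambda>(i, j). L2_inner M (e i) (\<lambda>z. z * e j z))"
  define S where "S = mat n n (\<lambda>(i, j). L2_inner M (e i) (w j))"
  define R where "R = mat n n (\<lambda>(j, m). c m j)"
  define T where "T = mat n n (\<lambda>(i, j). if i = j then a j else if i = Suc j then 1 else 0)"
  have carrier: "G \<in> carrier_mat n n" "S \<in> carrier_mat n n" "R \<in> carrier_mat n n" "T \<in> carrier_mat n n"
    by (simp_all add: G_def S_def R_def T_def)
  have SR: "S * R = 1\<^sub>m n"
  proof (rule eq_matI)
    fix i m assume im: "i < dim_row (1\<^sub>m n :: complex mat)" "m < dim_col (1\<^sub>m n :: complex mat)"
    have "(S * R) $$ (i, m) = (\<Sum>j<n. c m j * L2_inner M (e i) (w j))"
      using im carrier by (subst index_mult_square_mat) (auto simp: S_def R_def mult.commute)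
    also have "\<dots> = L2_inner M (e i) (e m)"
      using im by (intro inner_lincomb_right[symmetric]) (auto simp: c cont_e cont_w)
    finally show "(S * R) $$ (i, m) = 1\<^sub>m n $$ (i, m)"
      using im e by (simp add: orthonormal_inner)
  qed (use carrier in auto)
  have GS: "G * S = S * T"
  proof (rule eq_matI)
    fix i j assume "i < dim_row (S * T)" "j < dim_col (S * T)"
    then have ij: "i < n" "j < n"
      using carrier by auto
    have "(G * S) $$ (i, j) = (\<Sum>m<n. L2_inner M (e i) (\<lambda>z. z * e m z) * L2_inner M (e m) (w j))"
      using ij carrier by (subst index_mult_square_mat) (auto simp: G_def S_def)
    also have "\<dots> = L2_inner M (e i) (\<lambda>z. z * w j z)"
      using ij by (intro parseval_multiplication[symmetric] e w_e cont_e continuous_intros)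
    also have "\<dots> = L2_inner M (e i) (\<lambda>z. 1 * w (Suc j) z + a j * w j z)"
      by (simp add: w_Suc)
    also have "\<dots> = L2_inner M (e i) (w (Suc j)) + a j * L2_inner M (e i) (w j)"
      using ij by (subst inner_lincomb2_right) (auto simp: cont_e cont_w)
    \<comment> \<open>For \<open>Suc j = n\<close> no index of the sum matches, so the right-hand
      side is 0; the left-hand side is 0 by \<open>inner_w_n\<close>. This is why the last column of
      \<open>T\<close> needs no further entry.\<close>
    also have "L2_inner M (e i) (w (Suc j)) = (\<Sum>m<n. if m = Suc j then L2_inner M (e i) (w m) else 0)"
      using ij inner_w_n[OF ij(1)] by (cases "Suc j = n") auto
    also have "a j * L2_inner M (e i) (w j) = (\<Sum>m<n. if m = j then a j * L2_inner M (e i) (w m) else 0)"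
      using ij by simp
    also have "(\<Sum>m<n. if m = Suc j then L2_inner M (e i) (w m) else 0)
          + (\<Sum>m<n. if m = j then a j * L2_inner M (e i) (w m) else 0)
        = (\<Sum>m<n. L2_inner M (e i) (w m) * (if m = j then a j else if m = Suc j then 1 else 0))"
      unfolding sum.distrib[symmetric] by (rule sum.cong) auto
    also have "\<dots> = (S * T) $$ (i, j)"
      using ij carrier by (subst index_mult_square_mat) (auto simp: S_def T_def)
    finally show "(G * S) $$ (i, j) = (S * T) $$ (i, j)" .
  qed (use carrier in auto)
  have "mat_trace (G ^\<^sub>m k) = mat_trace (T ^\<^sub>m k)"
    using carrier GS SR by (intro mat_trace_pow_conjugate)
  also have "\<dots> = (\<Sum>i<n. (T $$ (i, i)) ^ k)"
    using carrier(4) by (rule mat_trace_pow_lower_triangular) (simp add: T_def)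
  also have "\<dots> = (\<Sum>i<n. a i ^ k)"
    by (rule sum.cong) (auto simp: T_def)
  finally show ?thesis
    by (simp add: G_def)
qed

section \<open>The CMV basis and its shifted polynomial spaces\<close>

definition CMV_exponent :: "nat \<Rightarrow> int" where
  "CMV_exponent n = (if even n then - int (n div 2) else int ((n + 1) div 2))"

lemma inj_CMV_exponent: "inj CMV_exponent"
proof (rule injI)
  fix i j assume "CMV_exponent i = CMV_exponent j"
  then show "i = j"
    by (auto simp: CMV_exponent_def elim!: evenE oddE split: if_splits)
qed

lemma CMV_monomial_eq: "CMV_monomial = (\<lambda>n z. z powi CMV_exponent n)"
  by (simp add: CMV_monomial_def CMV_exponent_def fun_eq_iff)

lemma continuous_CMV_monomial: "continuous_on (sphere 0 1) (CMV_monomial n)"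
  unfolding CMV_monomial_eq by (intro continuous_intros) auto

lemma CMV_monomial_independent:
  "f \<in> circle_span CMV_monomial n \<Longrightarrow> L2_nrm M (\<lambda>z. CMV_monomial n z - f z) \<noteq> 0"
  unfolding CMV_monomial_eq by (rule powi_independent[OF inj_CMV_exponent])

lemma CMV_basis_orthonormal: "orthonormal (CMV_basis M) n"
  unfolding CMV_basis_def
  by (rule gram_schmidt_L2_orthonormal[OF continuous_CMV_monomial CMV_monomial_independent])

text \<open>With l = (n - 1) div 2, the first n exponents 0, 1, -1, 2, -2, ... fill the block from
  -l to n - 1 - l. Shifted by l they become the degrees 0 to n - 1.\<close>

lemma CMV_basis_in_span:
  assumes "m < n"
  shows "CMV_basis M m \<in> circle_span (\<lambda>j z. z ^ j / z ^ ((n - 1) div 2)) n"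
proof (rule circle_span_trans)
  show "CMV_basis M m \<in> circle_span CMV_monomial (Suc m)"
    unfolding CMV_basis_def
    by (rule gram_schmidt_L2_in_span[OF continuous_CMV_monomial CMV_monomial_independent])
  fix i assume "i < Suc m"
  define l where "l = (n - 1) div 2"
  define j where "j = nat (int l + CMV_exponent i)"
  have "2 * l \<le> n - 1" "n - 1 < 2 * l + 2"
    by (auto simp: l_def)
  then have "0 \<le> int l + CMV_exponent i \<and> int l + CMV_exponent i < int n"
    using \<open>i < Suc m\<close> assms by (cases "even i") (auto simp: CMV_exponent_def elim!: evenE oddE)
  then have j: "int j = int l + CMV_exponent i" "j < n"
    by (auto simp: j_def nat_less_iff)
  have "(\<lambda>z. z ^ j / z ^ l) \<in> circle_span (\<lambda>j z. z ^ j / z ^ l) n"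
    using j(2) by (rule circle_span_base)
  moreover have "z ^ j / z ^ l = CMV_monomial i z" if "z \<in> sphere 0 1" for z
  proof -
    have "z \<noteq> 0" using that by auto
    then show ?thesis
      by (simp add: j CMV_monomial_eq power_int_add flip: power_int_of_nat)
  qed
  ultimately show "CMV_monomial i \<in> circle_span (\<lambda>j z. z ^ j / z ^ ((n - 1) div 2)) n"
    unfolding l_def[symmetric] by (rule circle_span_cong)
qed

lemma in_span_CMV_basis:
  assumes "j < n"
  shows "(\<lambda>z. z ^ j / z ^ ((n - 1) div 2)) \<in> circle_span (CMV_basis M) n"
proof -
  define l where "l = (n - 1) div 2"
  \<comment> \<open>The position of the exponent j - l in the sequence 0, 1, -1, 2, -2, ...:
    nonpositive exponents stand at even places, positive ones at odd places.\<close>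
  define i where "i = (if j \<le> l then 2 * (l - j) else 2 * (j - l) - 1)"
  have i: "int j = int l + CMV_exponent i" "i < n"
    using assms by (auto simp: i_def l_def CMV_exponent_def)
  have "CMV_monomial i \<in> circle_span (CMV_basis M) (Suc i)"
    unfolding CMV_basis_def
    by (rule in_span_gram_schmidt_L2[OF continuous_CMV_monomial CMV_monomial_independent])
  then have "CMV_monomial i \<in> circle_span (CMV_basis M) n"
    by (rule circle_span_mono) (use i in simp)
  then show ?thesis
    unfolding l_def[symmetric]
  proof (rule circle_span_cong)
    fix z :: complex assume "z \<in> sphere 0 1"
    then have "z \<noteq> 0" by auto
    then show "CMV_monomial i z = z ^ j / z ^ l"
      by (simp add: i CMV_monomial_eq power_int_add flip: power_int_of_nat)
  qed
qed

lemma trace_pow_CMV_trunc: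
  assumes "\<And>z. poly (monic_OP M n) z = (\<Prod>i<n. z - a i)"
  shows "mat_trace (CMV_trunc M n ^\<^sub>m k) = (\<Sum>i<n. a i ^ k)"
  unfolding CMV_trunc_def CMV_def
  by (rule trace_pow_compression[OF CMV_basis_orthonormal CMV_basis_in_span in_span_CMV_basis assms])

section \<open>The GGT matrix compared with multiplication by powers of z\<close>

definition GGT_trunc :: "nat \<Rightarrow> complex mat" where
  "GGT_trunc n = mat n n (\<lambda>(i, j). L2_inner M (OP i) (\<lambda>z. z * OP j z))"

lemma GGT_trunc_carrier [simp]: "GGT_trunc n \<in> carrier_mat n n"
  by (simp add: GGT_trunc_def)

lemma trace_pow_GGT_trunc:
  assumes "\<And>z. poly (monic_OP M n) z = (\<Prod>i<n. z - a i)"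
  shows "mat_trace (GGT_trunc n ^\<^sub>m k) = (\<Sum>i<n. a i ^ k)"
  unfolding GGT_trunc_def
proof (rule trace_pow_compression[OF OP_orthonormal _ _ assms])
  show "OP m \<in> circle_span (\<lambda>j z. z ^ j / z ^ 0) n" if "m < n" for m
    using circle_span_mono[OF OP_in_span] that by simp
  show "(\<lambda>z. z ^ j / z ^ 0) \<in> circle_span OP n" if "j < n" for j
    using circle_span_mono[OF power_in_span_OP] that by simp
qed

lemma GGT_trunc_pow_Suc:
  assumes "i < n" "j < n"
  shows "(GGT_trunc n ^\<^sub>m Suc k) $$ (i, j)
    = (\<Sum>m<n. L2_inner M (OP i) (\<lambda>z. z * OP m z) * (GGT_trunc n ^\<^sub>m k) $$ (m, j))"
  unfolding pow_mat_Suc_left[OF GGT_trunc_carrier]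
  by (subst index_mult_square_mat) (use assms in \<open>auto simp: GGT_trunc_def\<close>)

lemma continuous_OP: "continuous_on (sphere 0 1) (OP n)"
  using orthonormal_continuous[OF OP_orthonormal lessI] .

text \<open>Starting from degree \<open>j\<close>, the first k - 1 multiplications by z stay below
  degree \<open>n\<close>, so truncation discards nothing. The last one may reach degree
  \<open>n\<close> (hence \<open>\<le>\<close> in the hypothesis), but a row index
  \<open>i < n\<close> does not see that component.\<close>

lemma GGT_trunc_pow_entry:
  assumes "i < n" "j < n" "j + k \<le> n"
  shows "(GGT_trunc n ^\<^sub>m k) $$ (i, j) = L2_inner M (OP i) (\<lambda>z. z ^ k * OP j z)"
  using assms
proof (induction k arbitrary: i)
  case 0
  then show ?case
    using carrier_matD[OF GGT_trunc_carrier] orthonormal_inner[OF OP_orthonormal, of i n j] by simp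
next
  case (Suc k)
  \<comment> \<open>The degree is at most \<open>j + k\<close>, and \<open>j + Suc k \<le> n\<close>
    keeps this below \<open>n\<close>; this makes the following Parseval step exact.\<close>
  have "(\<lambda>z. z ^ k * OP j z) \<in> circle_span OP n"
    using OP_in_span
  proof (rule circle_span_mult)
    fix i assume "i < Suc j"
    then have "(\<lambda>z. z ^ (k + i)) \<in> circle_span OP n"
      using Suc.prems by (intro circle_span_mono[OF power_in_span_OP]) auto
    then show "(\<lambda>z. z ^ k * z ^ i) \<in> circle_span OP n"
      by (simp add: power_add)
  qed
  then have "L2_inner M (OP i) (\<lambda>z. z * (z ^ k * OP j z))
      = (\<Sum>m<n. L2_inner M (OP i) (\<lambda>z. z * OP m z) * L2_inner M (OP m) (\<lambda>z. z ^ k * OP j z))"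
    by (rule parseval_multiplication[OF OP_orthonormal]) (intro continuous_OP continuous_intros)+
  then show ?case
    using Suc by (simp add: GGT_trunc_pow_Suc mult.assoc del: pow_mat.simps)
qed

text \<open>The truncation compresses an isometry and is therefore a contraction; its powers send
  unit vectors to vectors of norm at most 1. This covers the last columns, where the formula for the
  entries fails.\<close>

lemma GGT_trunc_pow_column:
  assumes j: "j < n"
  shows "(\<Sum>i<n. (cmod ((GGT_trunc n ^\<^sub>m k) $$ (i, j)))\<^sup>2) \<le> 1"
proof (induction k)
  case 0
  have "(\<Sum>i<n. (cmod ((GGT_trunc n ^\<^sub>m 0) $$ (i, j)))\<^sup>2) = (\<Sum>i<n. if i = j then 1 else 0)"
    by (rule sum.cong) (use j carrier_matD[OF GGT_trunc_carrier] in auto)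
  then show ?case using j by simp
next
  case (Suc k)
  define v where "v i = (GGT_trunc n ^\<^sub>m k) $$ (i, j)" for i
  \<comment> \<open>The function whose coordinates form the \<open>j\<close>-th column of the
    \<open>k\<close>-th power. Multiplication by z preserves its norm, and Bessel's inequality
    accounts for the truncation.\<close>
  define f where "f z = (\<Sum>i<n. v i * OP i z)" for z
  have cf: "continuous_on (sphere 0 1) f"
    unfolding f_def by (intro continuous_intros continuous_OP)
  have inner_f: "L2_inner M h f = (\<Sum>i<n. v i * L2_inner M h (OP i))"
    if "continuous_on (sphere 0 1) h" for h
    by (rule inner_lincomb_right) (use that continuous_OP in \<open>auto simp: f_def\<close>)
  have "L2_inner M (OP i) f = v i" if "i < n" for i
  proof -
    have "(\<Sum>m<n. v m * L2_inner M (OP i) (OP m)) = (\<Sum>m<n. if m = i then v i else 0)"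
      by (rule sum.cong) (use that orthonormal_inner[OF OP_orthonormal[of n]] in auto)
    then show ?thesis
      using that by (simp add: inner_f continuous_OP)
  qed
  then have "L2_inner M f (OP i) = cnj (v i)" if "i < n" for i
    using that inner_commute[of "OP i" f] by simp
  then have "L2_inner M f f = of_real (\<Sum>i<n. (cmod (v i))\<^sup>2)"
    by (simp add: inner_f cf complex_norm_square del: of_real_power)
  then have nrm_f: "(L2_nrm M f)\<^sup>2 = (\<Sum>i<n. (cmod (v i))\<^sup>2)"
    by (simp only: inner_self of_real_eq_iff)
  have "(GGT_trunc n ^\<^sub>m Suc k) $$ (i, j) = L2_inner M (OP i) (\<lambda>z. z * f z)" if "i < n" for i
  proof -
    have "L2_inner M (OP i) (\<lambda>z. z * f z) = (\<Sum>m<n. v m * L2_inner M (OP i) (\<lambda>z. z * OP m z))"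
      by (rule inner_lincomb_right)
        (auto simp: f_def sum_distrib_left mult_ac intro!: continuous_intros continuous_OP)
    then show ?thesis
      using that j by (simp add: GGT_trunc_pow_Suc v_def mult.commute del: pow_mat.simps)
  qed
  then have "(\<Sum>i<n. (cmod ((GGT_trunc n ^\<^sub>m Suc k) $$ (i, j)))\<^sup>2)
      = (\<Sum>i<n. (cmod (L2_inner M (OP i) (\<lambda>z. z * f z)))\<^sup>2)"
    by simp
  also have "\<dots> \<le> (L2_nrm M (\<lambda>z. z * f z))\<^sup>2"
    by (rule bessel[OF OP_orthonormal]) (intro continuous_intros cf)
  also have "L2_nrm M (\<lambda>z. z * f z) = L2_nrm M f"
    by (rule nrm_cong) (simp add: norm_mult)
  also have "(L2_nrm M f)\<^sup>2 \<le> 1"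
    using Suc by (simp add: nrm_f v_def)
  finally show ?case .
qed

text \<open>Multiplication by z^k preserves the norm 1 of \<open>OP j\<close>, and Bessel's
  inequality bounds each coefficient of the result.\<close>

lemma norm_inner_OP_power_le_1: "cmod (L2_inner M (OP j) (\<lambda>z. z ^ k * OP j z)) \<le> 1"
proof (rule norm_le_1_of_sum_squares[of "\<lambda>i. L2_inner M (OP i) (\<lambda>z. z ^ k * OP j z)" "Suc j"])
  have "L2_inner M (OP j) (OP j) = 1"
    using orthonormal_inner[OF OP_orthonormal[of "Suc j"], of j j] by simp
  then have "(L2_nrm M (OP j))\<^sup>2 = 1"
    by (metis inner_self of_real_eq_1_iff)
  moreover have "L2_nrm M (\<lambda>z. z ^ k * OP j z) = L2_nrm M (OP j)"
    by (rule nrm_cong) (simp add: norm_mult norm_power)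
  ultimately show "(\<Sum>i<Suc j. (cmod (L2_inner M (OP i) (\<lambda>z. z ^ k * OP j z)))\<^sup>2) \<le> 1"
    using bessel[OF OP_orthonormal[of "Suc j"], of "\<lambda>z. z ^ k * OP j z"]
    by (simp add: continuous_intros continuous_OP)
qed simp

lemma trace_pow_GGT_trunc_diff:
  "cmod (mat_trace (GGT_trunc n ^\<^sub>m k) - (\<Sum>j<n. L2_inner M (OP j) (\<lambda>z. z ^ k * OP j z))) \<le> 2 * real k"
proof -
  define d where "d j = (GGT_trunc n ^\<^sub>m k) $$ (j, j) - L2_inner M (OP j) (\<lambda>z. z ^ k * OP j z)" for j
  have d_0: "d j = 0" if "j < n - k" for j
    using GGT_trunc_pow_entry[of j n j k] that by (simp add: d_def)
  have d_2: "cmod (d j) \<le> 2" if "j < n" for j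
    using norm_triangle_ineq4[of "(GGT_trunc n ^\<^sub>m k) $$ (j, j)" "L2_inner M (OP j) (\<lambda>z. z ^ k * OP j z)"]
      norm_le_1_of_sum_squares[OF GGT_trunc_pow_column[OF that, of k] that]
      norm_inner_OP_power_le_1[of j k]
    by (simp add: d_def)
  have "mat_trace (GGT_trunc n ^\<^sub>m k) - (\<Sum>j<n. L2_inner M (OP j) (\<lambda>z. z ^ k * OP j z)) = (\<Sum>j<n. d j)"
    using carrier_matD[OF GGT_trunc_carrier] by (simp add: mat_trace_def d_def sum_subtractf)
  \<comment> \<open>At most \<open>k\<close> indices remain. If \<open>k\<close> exceeds
    \<open>n\<close>, truncated subtraction makes this the whole range, which still has at most
    \<open>k\<close> elements.\<close>
  also have "\<dots> = (\<Sum>j\<in>{n - k..<n}. d j)"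
    by (rule sum.mono_neutral_right) (auto simp: d_0)
  finally have "cmod (mat_trace (GGT_trunc n ^\<^sub>m k) - (\<Sum>j<n. L2_inner M (OP j) (\<lambda>z. z ^ k * OP j z)))
      \<le> (\<Sum>j\<in>{n - k..<n}. 2)"
    by (simp only:) (rule sum_norm_le, use d_2 in auto)
  also have "\<dots> \<le> 2 * real k"
    by simp
  finally show ?thesis .
qed

subsection \<open>Moments\<close>

text \<open>The density contributes conjugate(phi_j) phi_j, so each summand is a diagonal matrix
  element of multiplication by z^k in the basis \<open>OP\<close>.\<close>

lemma integral_OP_average_measure:
  "(LINT z|OP_average_measure M n. z ^ k) = 1 / of_nat n * (\<Sum>j<n. L2_inner M (OP j) (\<lambda>z. z ^ k * OP j z))"
proof -
  have cont: "continuous_on (sphere 0 1) (orthonormal_OP M j)" for j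
    using continuous_OP[of j] by (subst continuous_on_cong[OF refl orthonormal_OP_eq])
  have "(LINT z|OP_average_measure M n. z ^ k)
      = (LINT z|M. (1 / real n * (\<Sum>j<n. (cmod (orthonormal_OP M j z))\<^sup>2)) *\<^sub>R z ^ k)"
    unfolding OP_average_measure_def
  proof (rule integral_density)
    show "(\<lambda>z. 1 / real n * (\<Sum>j<n. (cmod (orthonormal_OP M j z))\<^sup>2)) \<in> borel_measurable M"
      by (intro continuous_measurable continuous_on_mult_left continuous_intros cont)
  qed (auto intro!: continuous_measurable continuous_intros AE_I2 divide_nonneg_nonneg sum_nonneg)
  also have "\<dots> = (LINT z|M. 1 / of_nat n * (\<Sum>j<n. cnj (OP j z) * (z ^ k * OP j z)))"
  proof (rule Bochner_Integration.integral_cong)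
    fix z assume "z \<in> space M"
    then show "(1 / real n * (\<Sum>j<n. (cmod (orthonormal_OP M j z))\<^sup>2)) *\<^sub>R z ^ k
        = 1 / of_nat n * (\<Sum>j<n. cnj (OP j z) * (z ^ k * OP j z))"
      by (simp add: orthonormal_OP_eq scaleR_conv_of_real complex_norm_square sum_distrib_left
          sum_distrib_right mult_ac del: of_real_power)
  qed simp
  also have "\<dots> = 1 / of_nat n * (LINT z|M. (\<Sum>j<n. cnj (OP j z) * (z ^ k * OP j z)))"
    by simp
  also have "(LINT z|M. (\<Sum>j<n. cnj (OP j z) * (z ^ k * OP j z))) = (\<Sum>j<n. L2_inner M (OP j) (\<lambda>z. z ^ k * OP j z))"
    unfolding L2_inner_def
    by (rule Bochner_Integration.integral_sum) (intro continuous_integrable continuous_intros continuous_OP)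
  finally show ?thesis .
qed

lemma integral_zero_density:
  fixes g :: "complex \<Rightarrow> complex"
  assumes "g \<in> borel_measurable borel"
  shows "(LINT z|zero_density M n. g z) =
    1 / of_nat n * (\<Sum>z | poly (monic_OP M n) z = 0. of_nat (Polynomial.order z (monic_OP M n)) * g z)"
proof -
  have "monic_OP M n \<noteq> 0"
    using lead_coeff_monic_OP[of n] by auto
  then have fin: "finite {z. poly (monic_OP M n) z = 0}"
    by (rule poly_roots_finite)
  have "(LINT z|zero_density M n. g z) = (LINT z|point_measure {z. poly (monic_OP M n) z = 0}
      (\<lambda>z. ennreal (real (Polynomial.order z (monic_OP M n)) / real n)). g z)"
    unfolding zero_density_def by (rule integral_distr) (use assms in auto)
  also have "\<dots> = (\<Sum>z | poly (monic_OP M n) z = 0. (real (Polynomial.order z (monic_OP M n)) / real n) *\<^sub>R g z)"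
    by (rule lebesgue_integral_point_measure_finite[OF fin]) simp
  finally show ?thesis
    by (simp add: scaleR_conv_of_real sum_distrib_left mult_ac)
qed

text \<open>The same enumeration of the zeros is fed to both trace formulas. The CMV form is the
  first claim to be proved; the GGT form is the one comparable with the averaged measure.\<close>

lemma zero_density_traces:
  shows integral_zero_density_CMV:
      "(LINT z|zero_density M n. z ^ k) = 1 / of_nat n * mat_trace (CMV_trunc M n ^\<^sub>m k)"
    and integral_zero_density_GGT:
      "(LINT z|zero_density M n. z ^ k) = 1 / of_nat n * mat_trace (GGT_trunc n ^\<^sub>m k)"
proof -
  obtain a where a: "\<And>z. poly (monic_OP M n) z = (\<Prod>i<n. z - a i)"
    "\<And>g :: complex \<Rightarrow> complex. (\<Sum>z | poly (monic_OP M n) z = 0.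
        of_nat (Polynomial.order z (monic_OP M n)) * g z) = (\<Sum>i<n. g (a i))"
    using monic_poly_roots[OF lead_coeff_monic_OP degree_monic_OP] by blast
  have "(LINT z|zero_density M n. z ^ k) = 1 / of_nat n * (\<Sum>i<n. a i ^ k)"
    by (subst integral_zero_density) (simp_all add: a(2))
  then show "(LINT z|zero_density M n. z ^ k) = 1 / of_nat n * mat_trace (CMV_trunc M n ^\<^sub>m k)"
    "(LINT z|zero_density M n. z ^ k) = 1 / of_nat n * mat_trace (GGT_trunc n ^\<^sub>m k)"
    using trace_pow_CMV_trunc[OF a(1)] trace_pow_GGT_trunc[OF a(1)] by simp_all
qed

lemma moment_difference_tendsto_0:
  "(\<lambda>n. (LINT z|zero_density M n. z ^ k) - (LINT z|OP_average_measure M n. z ^ k)) \<longlonglongrightarrow> 0"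
proof (rule Lim_null_comparison)
  show "(\<lambda>n. 2 * real k * (1 / real n)) \<longlonglongrightarrow> 0"
    by (rule tendsto_mult_right_zero) (rule lim_1_over_n)
  show "\<forall>\<^sub>F n in sequentially. norm ((LINT z|zero_density M n. z ^ k) - (LINT z|OP_average_measure M n. z ^ k))
      \<le> 2 * real k * (1 / real n)"
  \<comment> \<open>The bound holds for every \<open>n\<close>: at \<open>n = 0\<close> both sides
    are 0, since division by 0 yields 0.\<close>
  proof (rule always_eventually, rule allI)
    fix n
    have "norm ((LINT z|zero_density M n. z ^ k) - (LINT z|OP_average_measure M n. z ^ k))
        = 1 / real n * cmod (mat_trace (GGT_trunc n ^\<^sub>m k) - (\<Sum>j<n. L2_inner M (OP j) (\<lambda>z. z ^ k * OP j z)))"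
      by (simp add: integral_zero_density_GGT integral_OP_average_measure norm_mult norm_divide
          flip: right_diff_distrib diff_divide_distrib)
    also have "\<dots> \<le> 1 / real n * (2 * real k)"
      by (intro mult_left_mono trace_pow_GGT_trunc_diff) simp
    finally show "norm ((LINT z|zero_density M n. z ^ k) - (LINT z|OP_average_measure M n. z ^ k))
        \<le> 2 * real k * (1 / real n)"
      by (simp add: mult.commute)
  qed
qed

end

theorem theorem3p7:
  fixes M :: "complex measure"
  assumes "nontrivial_circle_measure M"
  shows "(\<forall>(k::nat) n. n \<ge> 1 \<longrightarrow>
            (LINT z|zero_density M n. z ^ k) = 1 / of_nat n * mat_trace (CMV_trunc M n ^\<^sub>m k)) \<and>
         (\<forall>k::nat. (\<lambda>n. (LINT z|zero_density M n. z ^ k) - (LINT z|OP_average_measure M n. z ^ k))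
            \<longlonglongrightarrow> 0)"
proof -
  interpret circle_measure M
    by standard (rule assms)
  show ?thesis
    using integral_zero_density_CMV moment_difference_tendsto_0 by blast
qed

end
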